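(* For any integers $1\le n\le m$, we have $\theta_{m,n}\le -\xi$, where $\xi$ is the unique negative solution of the polynomial equation $$\mathcal{L}^{(-m-1)}_{n}(x)-\binom{2m}{2n}=0 .$$ Moreover, $$\theta_{m,n}\le (n!)^{1/n}\left(\binom{2m}{2n}-\binom{m}{n}\right)^{1/n}+2m-\left(1+(-1)^n\right).$$
   Context: For integers $0\le n\le m$, $\Pi_{m,n}$ is the class of polynomials $P(z)=\sum_{k=0}^m \alpha_k \frac{z^k}{k!}$ with $\alpha_0=\dots=\alpha_n=1$. For a real polynomial $P\in\Pi_{m,n}$ set $\theta(P)=\sup\{r>0 : |P(x)|\le 1 \text{ for all } x\in[-r,0]\}$; the parabolic stability radius $\theta_{m,n}$ is the supremum of $\theta(P)$ over all real polynomials $P\in\Pi_{m,n}$. For any real $\gamma$ (including negative values), the generalized Laguerre polynomial is defined by $\mathcal{L}_n^{(\gamma)}(x)=\sum_{\ell=0}^n\binom{n+\gamma}{n-\ell}\frac{(-x)^\ell}{\ell!}$, where $\binom{t}{\ell}=\frac{t(t-1)\cdots(t-\ell+1)}{\ell!}$ for $\ell>0$ and $\binom{t}{0}=1$. *)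

theory Defs
  imports
    Complex_Main
    "HOL-Library.Extended_Real"
    "HOL-Computational_Algebra.Polynomial"
begin

definition Pi_class :: "nat \<Rightarrow> nat \<Rightarrow> 'a::field_char_0 poly set" where
  "Pi_class m n =
     {P. \<exists>\<alpha>. (\<forall>k\<le>n. \<alpha> k = 1) \<and> P = (\<Sum>k\<le>m. monom (\<alpha> k / fact k) k)}"

(* The suprema are taken in the extended reals, so that a bound on them is never an artefact of
   the arbitrary value of a real supremum over an unbounded set.  If n is at least 1, every P in
   Pi_class m n has P(0) = P'(0) = 1, so the set of admissible r is nonempty and the supremum
   is positive (it is not the value of Sup at the empty set). *)

definition stability_radius :: "real poly \<Rightarrow> ereal" where
  "stability_radius P = (SUP r \<in> {r::real. r > 0 \<and> (\<forall>x\<in>{-r..0}. \<bar>poly P x\<bar> \<le> 1)}. ereal r)"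

definition parabolic_stability_radius :: "nat \<Rightarrow> nat \<Rightarrow> ereal" where
  "parabolic_stability_radius m n = (SUP P \<in> Pi_class m n. stability_radius P)"

definition gen_laguerre :: "nat \<Rightarrow> real \<Rightarrow> real \<Rightarrow> real" where
  "gen_laguerre n \<gamma> x =
     (\<Sum>l\<le>n. ((real n + \<gamma>) gchoose (n - l)) * ((- x) ^ l / fact l))"

end

theory Submission imports Defs begin

text \<open>
  If \<open>P\<close> has degree at most \<open>m\<close> and is bounded by \<open>1\<close> on \<open>[-r, 0]\<close>, expand \<open>t \<mapsto> P (- r t)\<close> on
  \<open>[0, 1]\<close> as \<open>\<Sum>j\<le>m. c j * t ^ j * (1 - t) ^ (m - j)\<close>. The number \<open>c n\<close> depends only on the first
  \<open>n + 1\<close> coefficients of \<open>P\<close>, so on the class under consideration it is the same for every \<open>P\<close>,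
  namely the value that the exponential series would give; this value is \<open>(- 1) ^ n\<close> times the
  Laguerre polynomial of degree \<open>n\<close> and parameter \<open>- m - 1\<close> at \<open>- r\<close>. Among polynomials of
  degree at most \<open>m\<close> bounded by \<open>1\<close> there, the shifted Chebyshev polynomial has the largest Bernstein coefficients in absolute value
  (\<open>bernstein_coeff_bound\<close>), and they are \<open>(2 m choose 2 n)\<close>. Hence every admissible \<open>r\<close> makes the
  absolute value of the Laguerre polynomial at \<open>- r\<close> at most \<open>(2 m choose 2 n)\<close>
  (\<open>admissible_imp_laguerre_le\<close>).

  It remains to study the Laguerre polynomial on the negative axis. Differentiation lowers both
  \<open>m\<close> and \<open>n\<close> by one up to sign, and for even \<open>n\<close> the polynomial is positive everywhere
  (\<open>exp_bernstein_even_pos\<close>). So it is strictly decreasing for odd \<open>n\<close> and strictly convex for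
  even \<open>n \<ge> 2\<close>. As its value at \<open>0\<close> is at most \<open>(2 m choose 2 n)\<close>, it meets this level at most once
  on the negative axis, and the sublevel set ends there (\<open>level_le_sublevel\<close>).

  For the explicit bound, a recurrence whose coefficients are nonnegative far out on the negative
  axis shows that at \<open>- (2 m - (1 + (- 1) ^ n))\<close> the polynomial is already at least \<open>(m choose n)\<close>
  (\<open>binomial_le_laguerre_reflected\<close>), and that \<open>a\<close> units further out it has grown by at least
  \<open>a ^ n / n!\<close> (\<open>laguerre_reflected_growth\<close>).
\<close>

section \<open>Bernstein coefficients of a bounded polynomial\<close>

text \<open>
  A polynomial with as many distinct positive roots as its degree is a multiple of
  \<open>\<Prod>a\<in>A. [:- a, 1:]\<close>, and each factor keeps the signs of the coefficients strictly alternating.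
  The point of interest is that no coefficient vanishes.
\<close>

lemma coeffs_alternate_if_roots_positive:
  fixes p :: "real poly"
  assumes "finite A" and "A \<subseteq> {0<..}" and "\<forall>a\<in>A. poly p a = 0"
    and "p \<noteq> 0" and "degree p \<le> card A"
  shows "\<exists>c. \<forall>j\<le>card A. 0 < c * (- 1) ^ j * coeff p j"
  using assms
proof (induction A arbitrary: p rule: finite_induct)
  case empty
  then obtain b where "p = [:b:]" "b \<noteq> 0"
    by (metis card.empty degree_eq_zeroE le_zero_eq pCons_0_0)
  then show ?case by (intro exI[of _ b]) (auto simp: not_sum_squares_lt_zero zero_less_mult_iff)
next
  case (insert a B)
  then obtain q where q: "p = [:- a, 1:] * q"
    by (metis dvdE insertI1 poly_eq_0_iff_dvd)
  have "q \<noteq> 0" using q insert.prems by auto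
  have "degree p = Suc (degree q)"
    using \<open>q \<noteq> 0\<close> by (simp add: q degree_mult_eq del: mult_pCons_left)
  then have deg: "degree q \<le> card B"
    using insert.prems insert.hyps by simp
  have "\<forall>b\<in>B. poly q b = 0"
    using insert.prems insert.hyps q by auto
  with insert.IH[of q] insert.prems \<open>q \<noteq> 0\<close> deg obtain c
    where c: "\<And>j. j \<le> card B \<Longrightarrow> 0 < c * (- 1) ^ j * coeff q j" by auto
  have "a > 0" using insert.prems by auto
  have "0 < - c * (- 1) ^ j * coeff p j" if j: "j \<le> Suc (card B)" for j
  proof (cases j)
    case 0
    have "0 < a * (c * (- 1) ^ 0 * coeff q 0)"
      by (intro mult_pos_pos[OF \<open>a > 0\<close> c]) simp
    also have "\<dots> = - c * (- 1) ^ j * coeff p j" by (simp add: q 0)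
    finally show ?thesis .
  next
    case (Suc i)
    have eq: "- c * (- 1) ^ j * coeff p j
        = c * (- 1) ^ i * coeff q i + a * (c * (- 1) ^ j * coeff q j)"
      by (simp add: q Suc coeff_pCons algebra_simps)
    have "0 \<le> a * (c * (- 1) ^ j * coeff q j)"
    proof (cases "j \<le> card B")
      case True
      then show ?thesis using mult_pos_pos[OF \<open>a > 0\<close> c[of j]] by simp
    next
      case False
      then have "coeff q j = 0" using deg by (intro coeff_eq_0) auto
      then show ?thesis by simp
    qed
    then show ?thesis using c[of i] eq j Suc by simp
  qed
  then show ?case using insert.hyps by (intro exI[of _ "- c"]) auto
qed

text \<open>
  With \<open>t = (sin \<phi>)\<^sup>2\<close> the left-hand side is the polynomial \<open>(- 1) ^ m * T\<^sub>m (2 t - 1)\<close> in Bernstein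
  form, where \<open>T\<^sub>m\<close> is the Chebyshev polynomial. The coefficients come from the real part of
  \<open>(cos \<phi> + \<i> * sin \<phi>) ^ (2 * m)\<close>, to which only the even powers of \<open>\<i> * sin \<phi>\<close> contribute.
\<close>

lemma chebyshev_bernstein:
  "(\<Sum>j\<le>m. (- 1) ^ j * real ((2 * m) choose (2 * j)) * (sin \<phi>)\<^sup>2 ^ j * (1 - (sin \<phi>)\<^sup>2) ^ (m - j))
    = cos (2 * real m * \<phi>)"
proof -
  let ?f = "\<lambda>k. of_nat ((2 * m) choose k) * (\<i> * complex_of_real (sin \<phi>)) ^ k
                  * complex_of_real (cos \<phi>) ^ (2 * m - k)"
  have "cis (2 * real m * \<phi>) = cis \<phi> ^ (2 * m)"
    by (simp add: Complex.DeMoivre)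
  also have "cis \<phi> = \<i> * complex_of_real (sin \<phi>) + complex_of_real (cos \<phi>)"
    by (simp add: complex_eq_iff)
  also have "\<dots> ^ (2 * m) = (\<Sum>k\<le>2 * m. ?f k)"
    by (simp add: binomial_ring)
  finally have "cos (2 * real m * \<phi>) = (\<Sum>k\<le>2 * m. Re (?f k))"
    by (metis Re_sum cis.sel(1))
  also have "\<dots> = (\<Sum>k\<in>(\<lambda>j. 2 * j) ` {..m}. Re (?f k))"
  proof (rule sum.mono_neutral_right)
    show "\<forall>k\<in>{..2 * m} - (\<lambda>j. 2 * j) ` {..m}. Re (?f k) = 0"
    proof
      fix k assume "k \<in> {..2 * m} - (\<lambda>j. 2 * j) ` {..m}"
      then have "odd k" by (auto elim!: evenE)
      then obtain i where "k = 2 * i + 1" by (elim oddE)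
      then have "?f k = \<i> * complex_of_real (real ((2 * m) choose k) * (- 1) ^ i * sin \<phi> ^ k
                                             * cos \<phi> ^ (2 * m - k))"
        by (simp add: power_mult_distrib power_mult
            power_minus[of "(complex_of_real (sin \<phi>))\<^sup>2"])
      then show "Re (?f k) = 0" by (metis Re_i_times Im_complex_of_real neg_0_equal_iff_equal)
    qed
  qed auto
  also have "\<dots> = (\<Sum>j\<le>m. Re (?f (2 * j)))"
    by (subst sum.reindex) (auto simp: inj_on_def)
  also have "\<dots> = (\<Sum>j\<le>m. (- 1) ^ j * real ((2 * m) choose (2 * j)) * (sin \<phi>)\<^sup>2 ^ j
                          * (1 - (sin \<phi>)\<^sup>2) ^ (m - j))"
  proof (rule sum.cong[OF refl])
    fix j assume "j \<in> {..m}"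
    have "2 * m - 2 * j = 2 * (m - j)" by simp
    then have "?f (2 * j) = complex_of_real (real ((2 * m) choose (2 * j)) * (- 1) ^ j
                * sin \<phi> ^ (2 * j) * cos \<phi> ^ (2 * (m - j)))"
      by (simp add: power_mult_distrib power_mult
          power_minus[of "(complex_of_real (sin \<phi>))\<^sup>2"])
    then have "Re (?f (2 * j)) = real ((2 * m) choose (2 * j)) * (- 1) ^ j
                * sin \<phi> ^ (2 * j) * cos \<phi> ^ (2 * (m - j))"
      by (metis Re_complex_of_real)
    moreover have "cos \<phi> ^ (2 * (m - j)) = (1 - (sin \<phi>)\<^sup>2) ^ (m - j)"
        "sin \<phi> ^ (2 * j) = (sin \<phi>)\<^sup>2 ^ j"
      by (simp_all add: power_mult cos_squared_eq)
    ultimately show "Re (?f (2 * j)) = (- 1) ^ j * real ((2 * m) choose (2 * j)) * (sin \<phi>)\<^sup>2 ^ j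
                          * (1 - (sin \<phi>)\<^sup>2) ^ (m - j)"
      by (simp only: mult_ac)
  qed
  finally show ?thesis by simp
qed

text \<open>
  If \<open>c n\<close> exceeded its Chebyshev counterpart, one could subtract from the Chebyshev polynomial a
  multiple \<open>\<kappa> p\<close> of the given \<open>p\<close> with \<open>\<bar>\<kappa>\<bar> < 1\<close> so that the \<open>n\<close>-th coefficient of the difference \<open>D\<close>
  vanishes. Since \<open>\<bar>\<kappa> p\<bar> < 1\<close>, the difference still alternates in sign at the \<open>m + 1\<close> Chebyshev nodes
  and thus has \<open>m\<close> roots inside the unit interval. The substitution \<open>w = t / (1 - t)\<close> makes the
  Bernstein coefficients ordinary coefficients and the roots positive, which contradicts
  \<open>coeffs_alternate_if_roots_positive\<close>.
\<close>

theorem bernstein_coeff_bound: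
  fixes c :: "nat \<Rightarrow> real"
  assumes bounded: "\<And>t. 0 \<le> t \<Longrightarrow> t \<le> 1 \<Longrightarrow> \<bar>\<Sum>j\<le>m. c j * t ^ j * (1 - t) ^ (m - j)\<bar> \<le> 1"
    and "n \<le> m"
  shows "\<bar>c n\<bar> \<le> real ((2 * m) choose (2 * n))"
proof (rule ccontr)
  let ?C = "\<lambda>j. real ((2 * m) choose (2 * j))"
  assume contra: "\<not> \<bar>c n\<bar> \<le> ?C n"
  \<comment> \<open>This factor makes the \<open>n\<close>-th coefficient \<open>d n\<close> of the difference vanish.\<close>
  define \<kappa> where "\<kappa> = (- 1) ^ n * ?C n / c n"
  have "c n \<noteq> 0" using contra by auto
  have "\<bar>\<kappa>\<bar> < 1" using contra by (auto simp: \<kappa>_def abs_mult)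
  define d where "d j = (- 1) ^ j * ?C j - \<kappa> * c j" for j
  have "d n = 0" using \<open>c n \<noteq> 0\<close> by (simp add: d_def \<kappa>_def)
  define D where "D t = (\<Sum>j\<le>m. d j * t ^ j * (1 - t) ^ (m - j))" for t :: real
  have D_eq: "D t = (\<Sum>j\<le>m. (- 1) ^ j * ?C j * t ^ j * (1 - t) ^ (m - j))
                  - \<kappa> * (\<Sum>j\<le>m. c j * t ^ j * (1 - t) ^ (m - j))" for t
    by (simp add: D_def d_def sum_distrib_left sum_subtractf algebra_simps)
  \<comment> \<open>The Chebyshev extrema; at \<open>node k\<close> the Chebyshev polynomial is \<open>cos (k * pi) = (- 1) ^ k\<close>.\<close>
  define node where "node k = (sin (real k * (pi / (2 * real m))))\<^sup>2" for k
  have node_range: "0 \<le> node k" "node k \<le> 1" for k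
    by (auto simp: node_def abs_square_le_1)
  have sign_at_node: "0 < (- 1) ^ k * D (node k)" if "k \<le> m" for k
  proof -
    let ?p = "\<Sum>j\<le>m. c j * node k ^ j * (1 - node k) ^ (m - j)"
    \<comment> \<open>For \<open>m = 0\<close> the only node is \<open>node 0 = 0\<close>, thanks to \<open>pi / 0 = 0\<close>.\<close>
    have "2 * real m * (real k * (pi / (2 * real m))) = real k * pi"
      using that by (cases "m = 0") auto
    then have "D (node k) = (- 1) ^ k - \<kappa> * ?p"
      using chebyshev_bernstein[of m "real k * (pi / (2 * real m))"]
      by (simp add: D_eq node_def cos_npi)
    moreover have "(- 1) ^ k * (- 1) ^ k = (1 :: real)"
      by (simp flip: power_mult_distrib)
    ultimately have "(- 1) ^ k * D (node k) = 1 - (- 1) ^ k * \<kappa> * ?p"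
      by (simp add: right_diff_distrib mult.assoc)
    moreover have "\<bar>\<kappa>\<bar> * \<bar>?p\<bar> \<le> \<bar>\<kappa>\<bar> * 1"
      by (intro mult_left_mono bounded node_range) auto
    then have "\<bar>(- 1) ^ k * \<kappa> * ?p\<bar> \<le> \<bar>\<kappa>\<bar>"
      by (simp add: abs_mult power_abs)
    ultimately show ?thesis using \<open>\<bar>\<kappa>\<bar> < 1\<close> by linarith
  qed
  have node_mono: "node k < node (Suc k)" if "k < m" for k
  proof -
    define u v where "u = real k * (pi / (2 * real m))" and "v = real (Suc k) * (pi / (2 * real m))"
    have "v \<le> real m * (pi / (2 * real m))"
      unfolding v_def using that by (intro mult_right_mono) auto
    also have "\<dots> = pi / 2" using that by simp
    finally have "v \<le> pi / 2" .
    moreover have "u < v"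
      unfolding u_def v_def using that by (intro mult_strict_right_mono) auto
    moreover have "0 \<le> u" by (simp add: u_def)
    ultimately have "0 \<le> sin u" "sin u < sin v"
      using pi_gt_zero by (auto intro!: sin_monotone_2pi sin_ge_zero simp del: pi_gt_zero)
    then show ?thesis unfolding node_def u_def v_def by (intro power_strict_mono) auto
  qed
  have "\<exists>t. node k < t \<and> t < node (Suc k) \<and> D t = 0" if "k < m" for k
  proof -
    let ?g = "\<lambda>t. (- 1) ^ k * D t"
    have "\<exists>t\<ge>node k. t \<le> node (Suc k) \<and> ?g t = 0"
    proof (rule IVT2')
      show "?g (node (Suc k)) \<le> 0" "0 \<le> ?g (node k)"
        using sign_at_node[of k] sign_at_node[of "Suc k"] that by auto
      show "node k \<le> node (Suc k)" using node_mono[OF that] by simp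
      show "continuous_on {node k..node (Suc k)} ?g"
        unfolding D_def by (intro continuous_intros)
    qed
    then obtain t where t: "node k \<le> t" "t \<le> node (Suc k)" "D t = 0" by auto
    have "t \<noteq> node k" "t \<noteq> node (Suc k)"
      using sign_at_node[of k] sign_at_node[of "Suc k"] that t by auto
    with t show ?thesis by (intro exI[of _ t]) auto
  qed
  then obtain \<tau> where \<tau>: "\<And>k. k < m \<Longrightarrow> node k < \<tau> k \<and> \<tau> k < node (Suc k) \<and> D (\<tau> k) = 0"
    by metis
  have node_mono': "node i \<le> node k" if "i \<le> k" "k \<le> m" for i k
    using that
  proof (induction k rule: dec_induct)
    case (step k)
    then show ?case using node_mono[of k] by simp
  qed simp
  have \<tau>_mono: "\<tau> i < \<tau> k" if "i < k" "k < m" for i k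
    using \<tau>[of i] \<tau>[of k] node_mono'[of "Suc i" k] that by auto
  have \<tau>_range: "0 < \<tau> k" "\<tau> k < 1" if "k < m" for k
    using \<tau>[OF that] node_range(1)[of k] node_range(2)[of "Suc k"] by auto
  \<comment> \<open>Dividing \<open>D t\<close> by \<open>(1 - t) ^ m\<close> turns it into the polynomial \<open>q\<close> in \<open>t / (1 - t)\<close>.\<close>
  define w where "w k = \<tau> k / (1 - \<tau> k)" for k
  have "inj_on w {..<m}"
  proof (rule inj_onI)
    fix i k assume *: "i \<in> {..<m}" "k \<in> {..<m}" "w i = w k"
    then have "\<tau> i = \<tau> k"
      using \<tau>_range[of i] \<tau>_range[of k] by (simp add: w_def field_simps)
    then show "i = k" using \<tau>_mono * by (metis lessThan_iff less_irrefl linorder_neqE_nat)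
  qed
  then have card: "card (w ` {..<m}) = m" by (simp add: card_image)
  define q where "q = (\<Sum>j\<le>m. monom (d j) j)"
  have coeff_q: "coeff q j = d j" if "j \<le> m" for j
    using that by (simp add: q_def coeff_sum)
  have "\<exists>c. \<forall>j\<le>card (w ` {..<m}). 0 < c * (- 1) ^ j * coeff q j"
  proof (rule coeffs_alternate_if_roots_positive)
    show "w ` {..<m} \<subseteq> {0<..}" using \<tau>_range by (auto simp: w_def)
    show "degree q \<le> card (w ` {..<m})"
      unfolding card q_def by (intro degree_sum_le) (auto intro: order.trans[OF degree_monom_le])
    have "D (node 0) = d 0"
      unfolding D_def node_def by (simp add: sum.atMost_shift)
    then have "d 0 \<noteq> 0" using sign_at_node[of 0] by auto
    then show "q \<noteq> 0" using coeff_q[of 0] by auto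
    show "\<forall>a\<in>w ` {..<m}. poly q a = 0"
    proof
      fix a assume "a \<in> w ` {..<m}"
      then obtain k where k: "k < m" "a = w k" by auto
      have "D (\<tau> k) = (1 - \<tau> k) ^ m * poly q a"
        unfolding D_def q_def poly_sum sum_distrib_left
      proof (rule sum.cong[OF refl])
        fix j assume "j \<in> {..m}"
        then have "(1 - \<tau> k) ^ m = (1 - \<tau> k) ^ j * (1 - \<tau> k) ^ (m - j)"
          by (simp flip: power_add)
        then show "d j * \<tau> k ^ j * (1 - \<tau> k) ^ (m - j) = (1 - \<tau> k) ^ m * poly (monom (d j) j) a"
          using \<tau>_range[OF k(1)] by (simp add: poly_monom k w_def power_divide)
      qed
      then show "poly q a = 0" using \<tau>[OF k(1)] \<tau>_range[OF k(1)] by auto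
    qed
  qed auto
  then show False using coeff_q[OF \<open>n \<le> m\<close>] \<open>d n = 0\<close> \<open>n \<le> m\<close> card
    by (metis less_irrefl mult_zero_right)
qed

text \<open>
  Multiply each \<open>t ^ l\<close> by \<open>1 = (t + (1 - t)) ^ (m - l)\<close> and expand.
\<close>

lemma bernstein_form:
  fixes a :: "nat \<Rightarrow> real"
  shows "(\<Sum>l\<le>m. a l * t ^ l)
    = (\<Sum>j\<le>m. (\<Sum>l\<le>j. real ((m - l) choose (j - l)) * a l) * t ^ j * (1 - t) ^ (m - j))"
proof -
  have "a l * t ^ l = (\<Sum>j\<in>{l..m}. real ((m - l) choose (j - l)) * a l * t ^ j * (1 - t) ^ (m - j))"
    if "l \<le> m" for l
  proof -
    have "(\<Sum>j\<in>{l..m}. real ((m - l) choose (j - l)) * a l * t ^ j * (1 - t) ^ (m - j))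
        = (\<Sum>i\<le>m - l. real ((m - l) choose i) * a l * t ^ (i + l) * (1 - t) ^ (m - (i + l)))"
      using that
      by (intro sum.reindex_bij_witness[of _ "\<lambda>i. i + l" "\<lambda>j. j - l"]) auto
    also have "\<dots> = a l * t ^ l * (t + (1 - t)) ^ (m - l)"
      unfolding binomial_ring sum_distrib_left
      by (intro sum.cong refl) (simp add: power_add mult_ac add.commute diff_diff_left)
    finally show ?thesis by simp
  qed
  then have "(\<Sum>l\<le>m. a l * t ^ l)
      = (\<Sum>l\<le>m. \<Sum>j\<in>{l..m}. real ((m - l) choose (j - l)) * a l * t ^ j * (1 - t) ^ (m - j))"
    by (intro sum.cong) auto
  also have "\<dots> = (\<Sum>j\<le>m. \<Sum>l\<le>j. real ((m - l) choose (j - l)) * a l * t ^ j * (1 - t) ^ (m - j))"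
    unfolding sum.Sigma[OF finite_atMost ballI[OF finite_atLeastAtMost]]
      sum.Sigma[OF finite_atMost ballI[OF finite_atMost]]
    by (intro sum.reindex_bij_witness[of _ prod.swap prod.swap]) auto
  finally show ?thesis by (simp add: sum_distrib_right)
qed

section \<open>Laguerre polynomials with parameter below minus their degree\<close>

text \<open>
  By \<open>bernstein_form\<close> this is the \<open>n\<close>-th Bernstein coefficient on \<open>[0, 1]\<close> of \<open>t \<mapsto> exp (x t)\<close>, with
  the exponential series cut off anywhere between degree \<open>n\<close> and degree \<open>m\<close>. It equals the Laguerre
  polynomial of parameter \<open>- m - 1\<close> up to sign, but all its coefficients are nonnegative.
\<close>

definition exp_bernstein :: "nat \<Rightarrow> nat \<Rightarrow> real \<Rightarrow> real" where
  "exp_bernstein m n x = (\<Sum>l\<le>n. real ((m - l) choose (n - l)) * (x ^ l / fact l))"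

lemma gen_laguerre_eq_exp_bernstein:
  assumes "n \<le> m"
  shows "gen_laguerre n (- real m - 1) x = (- 1) ^ n * exp_bernstein m n x"
  unfolding gen_laguerre_def exp_bernstein_def sum_distrib_left
proof (rule sum.cong[OF refl])
  fix l assume "l \<in> {..n}"
  then have "l \<le> n" by simp
  have "real (n - l) - (real n + (- real m - 1)) - 1 = real (m - l)"
    using \<open>l \<le> n\<close> assms by simp
  then have "(real n + (- real m - 1)) gchoose (n - l) = (- 1) ^ (n - l) * real ((m - l) choose (n - l))"
    by (subst gbinomial_negated_upper) (simp add: binomial_gbinomial)
  moreover have "(- x) ^ l = (- 1) ^ l * x ^ l" by (rule power_minus)
  moreover have "(- 1 :: real) ^ n = (- 1) ^ (n - l) * (- 1) ^ l"
    using \<open>l \<le> n\<close> by (simp flip: power_add)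
  ultimately show "(real n + (- real m - 1) gchoose (n - l)) * ((- x) ^ l / fact l)
      = (- 1) ^ n * (real ((m - l) choose (n - l)) * (x ^ l / fact l))"
    by simp
qed

lemma exp_bernstein_0 [simp]: "exp_bernstein m 0 x = 1"
  by (simp add: exp_bernstein_def)

lemma exp_bernstein_at_0 [simp]: "exp_bernstein m n 0 = real (m choose n)"
  by (simp add: exp_bernstein_def sum.atMost_shift)

lemma power_over_fact_deriv:
  "((\<lambda>x::real. x ^ Suc l / fact (Suc l)) has_real_derivative x ^ l / fact l) (at x)"
proof -
  have "((\<lambda>x. x ^ Suc l / fact (Suc l)) has_real_derivative
      (real (Suc l) * x ^ l) / fact (Suc l)) (at x)"
    using DERIV_cdivide[OF DERIV_pow[of "Suc l" x UNIV], of "fact (Suc l)"]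
    by (simp del: fact_Suc of_nat_Suc power_Suc)
  moreover have "(real (Suc l) * x ^ l) / fact (Suc l) = x ^ l / fact l"
    unfolding fact_Suc by (rule mult_divide_mult_cancel_left) simp
  ultimately show ?thesis by (simp only:)
qed

lemma exp_bernstein_deriv:
  "(exp_bernstein (Suc m) (Suc n) has_real_derivative exp_bernstein m n x) (at x)"
proof -
  have "((\<lambda>x. real (Suc m choose Suc n)
        + (\<Sum>l\<le>n. real ((m - l) choose (n - l)) * (x ^ Suc l / fact (Suc l))))
      has_real_derivative 0 + (\<Sum>l\<le>n. real ((m - l) choose (n - l)) * (x ^ l / fact l))) (at x)"
    by (intro DERIV_add DERIV_const DERIV_sum DERIV_cmult power_over_fact_deriv)
  moreover have "exp_bernstein (Suc m) (Suc n) = (\<lambda>x. real (Suc m choose Suc n)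
        + (\<Sum>l\<le>n. real ((m - l) choose (n - l)) * (x ^ Suc l / fact (Suc l))))"
    by (rule ext) (simp add: exp_bernstein_def sum.atMost_Suc_shift del: sum.atMost_Suc)
  ultimately show ?thesis by (simp add: exp_bernstein_def)
qed

lemma exp_bernstein_diagonal: 
  "exp_bernstein (Suc n) (Suc n) x = x ^ Suc n / fact (Suc n) + exp_bernstein n n x"
  by (simp add: exp_bernstein_def)

lemma exp_bernstein_pascal:
  assumes "n < m"
  shows "exp_bernstein (Suc m) (Suc n) x = exp_bernstein m (Suc n) x + exp_bernstein m n x"
proof -
  have "(Suc m - l) choose (Suc n - l) = ((m - l) choose (Suc n - l)) + ((m - l) choose (n - l))"
    if "l \<le> n" for l
    using that assms by (simp add: Suc_diff_le)
  then show ?thesis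
    by (simp add: exp_bernstein_def distrib_right sum.distrib add_divide_distrib)
qed

text \<open>
  Write \<open>Suc n = l + (Suc n - l)\<close> in the \<open>l\<close>-th term. The weight \<open>l\<close> is the effect of
  \<open>x * (d / dx)\<close>, and the weight \<open>Suc n - l\<close> is absorbed by the binomial coefficient.
\<close>

lemma exp_bernstein_euler:
  assumes "n \<le> m"
  shows "real (Suc n) * exp_bernstein (Suc m) (Suc n) x
    = x * exp_bernstein m n x + real (Suc m - n) * exp_bernstein (Suc m) n x"
proof -
  let ?t = "\<lambda>l. real ((Suc m - l) choose (Suc n - l)) * (x ^ l / fact l)"
  have "(\<Sum>l\<le>Suc n. real l * ?t l) = (\<Sum>l\<le>n. real (Suc l) * ?t (Suc l))"
    by (simp add: sum.atMost_Suc_shift del: sum.atMost_Suc)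
  also have "\<dots> = x * exp_bernstein m n x"
    unfolding exp_bernstein_def sum_distrib_left
    by (intro sum.cong refl) (simp add: fact_Suc field_simps del: of_nat_Suc)
  finally have weighted: "(\<Sum>l\<le>Suc n. real l * ?t l) = x * exp_bernstein m n x" .
  have "(\<Sum>l\<le>Suc n. real (Suc n - l) * ?t l) = (\<Sum>l\<le>n. real (Suc n - l) * ?t l)"
    by simp
  also have "\<dots> = real (Suc m - n) * exp_bernstein (Suc m) n x"
    unfolding exp_bernstein_def sum_distrib_left
  proof (rule sum.cong[OF refl])
    fix l assume "l \<in> {..n}"
    then have l: "l \<le> n" by simp
    define M k where "M = Suc m - l" and "k = n - l"
    have "Suc k * (M choose Suc k) = (M - k) * (M choose k)"
      by (metis binomial_absorb_comp binomial_absorption)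
    moreover have "Suc n - l = Suc k" "M - k = Suc m - n"
      using l assms by (auto simp: M_def k_def)
    ultimately have "(Suc n - l) * ((Suc m - l) choose (Suc n - l))
        = (Suc m - n) * ((Suc m - l) choose (n - l))"
      by (simp add: M_def k_def)
    then have "real (Suc n - l) * real ((Suc m - l) choose (Suc n - l))
        = real (Suc m - n) * real ((Suc m - l) choose (n - l))"
      by (metis of_nat_mult)
    then show "real (Suc n - l) * ?t l
        = real (Suc m - n) * (real ((Suc m - l) choose (n - l)) * (x ^ l / fact l))"
      by (metis mult.assoc)
  qed
  finally have coweighted: "(\<Sum>l\<le>Suc n. real (Suc n - l) * ?t l)
      = real (Suc m - n) * exp_bernstein (Suc m) n x" .
  have "real (Suc n) * exp_bernstein (Suc m) (Suc n) x
      = (\<Sum>l\<le>Suc n. real l * ?t l + real (Suc n - l) * ?t l)"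
    unfolding exp_bernstein_def sum_distrib_left
  proof (rule sum.cong[OF refl])
    fix l assume "l \<in> {..Suc n}"
    then have "real (Suc n) = real l + real (Suc n - l)" by (simp add: of_nat_diff)
    then show "real (Suc n) * ?t l = real l * ?t l + real (Suc n - l) * ?t l"
      by (simp only: distrib_right)
  qed
  then show ?thesis by (simp only: sum.distrib weighted coweighted)
qed

text \<open>
  The derivative of \<open>f = exp_bernstein m n\<close> is at most \<open>f\<close>: the difference \<open>f - f'\<close> is
  \<open>exp_bernstein (m - 1) n\<close> for \<open>n < m\<close>, which is positive by induction, and \<open>x ^ n / n!\<close> for
  \<open>n = m\<close>. So \<open>exp (- x) * f x\<close> is nonincreasing, and for negative \<open>x\<close> it is at least its value
  \<open>(m choose n)\<close> at \<open>0\<close>. For positive \<open>x\<close> every term of \<open>f\<close> is positive.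
\<close>

lemma exp_bernstein_even_pos:
  assumes "even n" and "n \<le> m"
  shows "0 < exp_bernstein m n x"
  using assms(2)
proof (induction m arbitrary: x rule: dec_induct)
  \<comment> \<open>The decrease of \<open>exp (- x) * f x\<close> follows from \<open>f' \<le> f\<close>, which the base case and the step supply in turn.\<close>
  have of_decreasing: "0 < exp_bernstein m n x"
    if "n \<le> m" and deriv: "\<And>x. \<exists>D\<le>exp_bernstein m n x. (exp_bernstein m n has_real_derivative D) (at x)"
    for m x
  proof (cases "x \<le> 0")
    case True
    have "exp (- 0) * exp_bernstein m n 0 \<le> exp (- x) * exp_bernstein m n x"
    proof (rule DERIV_nonpos_imp_nonincreasing[OF True])
      fix u
      obtain D where "D \<le> exp_bernstein m n u"
        and D: "(exp_bernstein m n has_real_derivative D) (at u)" using deriv by blast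
      moreover have "((\<lambda>u. exp (- u) * exp_bernstein m n u) has_real_derivative
          exp (- u) * (D - exp_bernstein m n u)) (at u)"
        by (auto intro!: derivative_eq_intros D simp: algebra_simps)
      ultimately show "\<exists>y. ((\<lambda>u. exp (- u) * exp_bernstein m n u) has_real_derivative y) (at u) \<and> y \<le> 0"
        by (intro exI conjI) (auto intro: mult_nonneg_nonpos)
    qed
    moreover have "0 < exp (- 0) * exp_bernstein m n 0" using \<open>n \<le> m\<close> by simp
    ultimately have "0 < exp (- x) * exp_bernstein m n x" by linarith
    then show ?thesis by (simp add: zero_less_mult_iff)
  next
    case False
    then have "0 < (\<Sum>l\<le>n. real ((m - l) choose (n - l)) * (x ^ l / fact l))"
      using \<open>n \<le> m\<close> by (intro sum_pos mult_pos_pos) auto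
    then show ?thesis by (simp add: exp_bernstein_def)
  qed
  {
    case base
    show ?case
    proof (cases n)
      case (Suc k)
      show ?thesis
      proof (rule of_decreasing[OF order.refl])
        fix u :: real
        have "0 \<le> u ^ Suc k / fact (Suc k)"
          using zero_le_even_power[of n u] assms(1) Suc by (simp del: power_Suc fact_Suc)
        then have "exp_bernstein k k u \<le> exp_bernstein n n u"
          using exp_bernstein_diagonal[of k u] Suc by simp
        then show "\<exists>D\<le>exp_bernstein n n u. (exp_bernstein n n has_real_derivative D) (at u)"
          using exp_bernstein_deriv[of k k u] Suc by auto
      qed
    qed simp
  next
    case (step m)
    show ?case
    proof (cases n)
      case (Suc k)
      show ?thesis
      proof (rule of_decreasing)
        show "n \<le> Suc m" using step by simp
        fix u
        have "exp_bernstein m k u \<le> exp_bernstein (Suc m) n u"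
          using exp_bernstein_pascal[of k m u] step.hyps step.IH[of u] Suc by simp
        then show "\<exists>D\<le>exp_bernstein (Suc m) n u. (exp_bernstein (Suc m) n has_real_derivative D) (at u)"
          using exp_bernstein_deriv[of m k u] Suc by auto
      qed
    qed simp
  }
qed

lemma exp_bernstein_odd_strict_mono:
  assumes "odd n" and "n \<le> m" and "x < y"
  shows "exp_bernstein m n x < exp_bernstein m n y"
proof (rule DERIV_pos_imp_increasing[OF assms(3)])
  fix u
  obtain k where k: "n = Suc k" using assms(1) by (cases n) auto
  obtain M where M: "m = Suc M" using assms(2) k by (cases m) auto
  show "\<exists>D. (exp_bernstein m n has_real_derivative D) (at u) \<and> 0 < D"
    using exp_bernstein_deriv[of M k u] exp_bernstein_even_pos[of k M u] assms k M by auto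
qed

text \<open>
  The square of \<open>m choose n\<close> is the middle term of the Vandermonde sum for \<open>2 m choose 2 n\<close>.
\<close>

lemma binomial_le_binomial_double: "m choose n \<le> (2 * m) choose (2 * n)"
proof -
  have "m choose n \<le> (m choose n) * (m choose (2 * n - n))"
    by (cases "m choose n") auto
  also have "\<dots> \<le> (\<Sum>k\<le>2 * n. (m choose k) * (m choose (2 * n - k)))"
    by (rule member_le_sum) auto
  also have "\<dots> = (2 * m) choose (2 * n)"
    using vandermonde[of m m "2 * n"] by (simp add: mult_2)
  finally show ?thesis .
qed

text \<open>
  For odd \<open>n\<close> the Laguerre polynomial is strictly decreasing. For even \<open>n\<close> it is strictly convex and
  at most \<open>C\<close> at \<open>0\<close>, so a point \<open>x < \<xi>\<close> of the sublevel set would place the level point \<open>\<xi>\<close> strictly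
  between two points of the sublevel set.
\<close>

lemma level_le_sublevel:
  assumes "n \<le> m" and "x < 0" and "\<xi> < 0"
    and C: "real (m choose n) \<le> C"
    and x: "gen_laguerre n (- real m - 1) x \<le> C" and \<xi>: "gen_laguerre n (- real m - 1) \<xi> = C"
    and "1 \<le> n"
  shows "\<xi> \<le> x"
proof (rule ccontr)
  assume "\<not> \<xi> \<le> x"
  then have "x < \<xi>" by simp
  show False
  proof (cases "even n")
    case False
    then show False using exp_bernstein_odd_strict_mono[of n m x \<xi>] \<open>x < \<xi>\<close> assms
      by (simp add: gen_laguerre_eq_exp_bernstein)
  next
    case True
    obtain k M where kM: "n = Suc k" "m = Suc M"
      using assms by (metis Suc_le_D order.trans One_nat_def)
    have val: "exp_bernstein m n x \<le> C" "exp_bernstein m n \<xi> = C" "exp_bernstein m n 0 \<le> C"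
      using x \<xi> C True \<open>n \<le> m\<close> by (auto simp: gen_laguerre_eq_exp_bernstein)
    \<comment> \<open>Mean values on both sides of \<open>\<xi>\<close> give derivatives in the wrong order for a convex function.\<close>
    obtain z1 where z1: "x < z1" "z1 < \<xi>"
        "exp_bernstein m n \<xi> - exp_bernstein m n x = (\<xi> - x) * exp_bernstein M k z1"
      using MVT2[OF \<open>x < \<xi>\<close>, of "exp_bernstein m n" "exp_bernstein M k"] exp_bernstein_deriv kM by auto
    obtain z2 where z2: "\<xi> < z2" "z2 < 0"
        "exp_bernstein m n 0 - exp_bernstein m n \<xi> = (0 - \<xi>) * exp_bernstein M k z2"
      using MVT2[OF \<open>\<xi> < 0\<close>, of "exp_bernstein m n" "exp_bernstein M k"] exp_bernstein_deriv kM by auto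
    have "0 \<le> (\<xi> - x) * exp_bernstein M k z1" using z1(3) val by linarith
    then have "0 \<le> exp_bernstein M k z1"
      using \<open>x < \<xi>\<close> by (simp add: zero_le_mult_iff)
    moreover have "(0 - \<xi>) * exp_bernstein M k z2 \<le> 0" using z2(3) val by linarith
    then have "exp_bernstein M k z2 \<le> 0"
      using \<open>\<xi> < 0\<close> by (simp add: zero_le_mult_iff)
    moreover have "exp_bernstein M k z1 < exp_bernstein M k z2"
      using True kM z1 z2 assms by (intro exp_bernstein_odd_strict_mono) auto
    ultimately show False by simp
  qed
qed

section \<open>Growth on the negative axis\<close>

text \<open>
  The reflection lets arguments far out on the negative axis be large positive numbers, and makes
  differentiation lower both indices without a change of sign.
\<close>

abbreviation laguerre_reflected :: "nat \<Rightarrow> nat \<Rightarrow> real \<Rightarrow> real" where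
  "laguerre_reflected m n y \<equiv> gen_laguerre n (- real m - 1) (- y)"

lemma laguerre_reflected_deriv:
  assumes "n \<le> m"
  shows "(laguerre_reflected (Suc m) (Suc n) has_real_derivative laguerre_reflected m n y) (at y)"
proof -
  have "((\<lambda>y. (- 1) ^ Suc n * exp_bernstein (Suc m) (Suc n) (- y)) has_real_derivative
      (- 1) ^ Suc n * (exp_bernstein m n (- y) * - 1)) (at y)"
    by (intro DERIV_cmult DERIV_chain2[OF exp_bernstein_deriv])
       (auto intro!: derivative_eq_intros)
  then show ?thesis
    using assms by (simp add: gen_laguerre_eq_exp_bernstein del: of_nat_Suc)
qed

text \<open>
  Obtained from \<open>exp_bernstein_euler\<close> by using \<open>exp_bernstein_pascal\<close> to lower \<open>m\<close> in its last term.
  In this form both coefficients on the right are nonnegative once \<open>m - n \<le> y\<close>, so lower bounds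
  can be pushed through it.
\<close>

lemma laguerre_reflected_recurrence:
  assumes "n < m"
  shows "real (n + 2) * laguerre_reflected (Suc m) (n + 2) y
    = (y - real (m - n)) * laguerre_reflected m (Suc n) y + real (m - n) * laguerre_reflected m n y"
proof -
  have "real (Suc (Suc n)) * exp_bernstein (Suc m) (Suc (Suc n)) (- y)
      = - y * exp_bernstein m (Suc n) (- y)
        + real (m - n) * (exp_bernstein m (Suc n) (- y) + exp_bernstein m n (- y))"
    using exp_bernstein_euler[of "Suc n" m "- y"] exp_bernstein_pascal[of n m "- y"] assms by simp
  then have "(- 1) ^ n * (real (Suc (Suc n)) * exp_bernstein (Suc m) (Suc (Suc n)) (- y))
      = (- 1) ^ n * (- y * exp_bernstein m (Suc n) (- y)
        + real (m - n) * (exp_bernstein m (Suc n) (- y) + exp_bernstein m n (- y)))"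
    by simp
  then show ?thesis
    using assms by (simp add: gen_laguerre_eq_exp_bernstein algebra_simps del: of_nat_Suc)
qed

text \<open>
  Induction along \<open>laguerre_reflected_recurrence\<close>. Inserting the lower bounds for \<open>n - 1\<close> and
  \<open>n - 2\<close> bounds \<open>n\<close> times the polynomial below by \<open>(m - 1) choose (n - 1)\<close> times a factor that is
  at least \<open>m + 2 n - 4\<close>. A factor \<open>m\<close> is needed, since \<open>n * (m choose n)\<close> is \<open>m\<close> times the same
  binomial coefficient, and \<open>n \<ge> 2\<close> provides it. For \<open>n = 1\<close> the polynomial is \<open>y - m\<close>, whence the stronger
  hypothesis in that case.
\<close>

lemma binomial_le_laguerre_reflected:
  assumes "n \<le> m" and "2 * real m - 2 \<le> y" and "n = 1 \<Longrightarrow> 2 * real m \<le> y"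
  shows "real (m choose n) \<le> laguerre_reflected m n y"
  using assms
proof (induction n arbitrary: m rule: less_induct)
  case (less n)
  consider "n = 0" | "n = 1" | k where "n = k + 2"
    by (metis One_nat_def Suc_1 add_2_eq_Suc' not0_implies_Suc)
  then show ?case
  proof cases
    case 1
    then show ?thesis by (simp add: gen_laguerre_eq_exp_bernstein)
  next
    case 2
    then show ?thesis using less.prems by (simp add: gen_laguerre_eq_exp_bernstein exp_bernstein_def)
  next
    case 3
    obtain M where M: "m = Suc M" using less.prems 3 by (cases m) auto
    have "k < M" using less.prems 3 M by simp
    have y: "2 * real M \<le> y" using less.prems M by simp
    have IH: "real (M choose Suc k) \<le> laguerre_reflected M (Suc k) y"
        "real (M choose k) \<le> laguerre_reflected M k y"
      using less.IH[of "Suc k" M] less.IH[of k M] 3 \<open>k < M\<close> y by auto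
    have absorb: "real (M - k) * real (M choose k) = real (Suc k) * real (M choose Suc k)"
      by (metis binomial_absorb_comp binomial_absorption of_nat_mult)
    have "real n * real (m choose n) = real (Suc M) * real (M choose Suc k)"
      unfolding M 3 by (metis Suc_times_binomial add_2_eq_Suc' of_nat_mult)
    also have "\<dots> \<le> (y - real (M - k) + real (Suc k)) * real (M choose Suc k)"
      using y \<open>k < M\<close> by (intro mult_right_mono) (auto simp: of_nat_diff)
    also have "\<dots> = (y - real (M - k)) * real (M choose Suc k) + real (M - k) * real (M choose k)"
      using absorb by (simp add: distrib_right)
    also have "\<dots> \<le> (y - real (M - k)) * laguerre_reflected M (Suc k) y
                    + real (M - k) * laguerre_reflected M k y"
      using IH y \<open>k < M\<close> by (intro add_mono mult_left_mono) (auto simp: of_nat_diff)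
    also have "\<dots> = real n * laguerre_reflected m n y"
      using laguerre_reflected_recurrence[OF \<open>k < M\<close>, of y] by (simp add: M 3)
    finally show ?thesis using 3 by (simp del: of_nat_add)
  qed
qed

text \<open>
  The case \<open>n = 1\<close> is linear. For \<open>n \<ge> 2\<close>, by induction, the derivative at \<open>b + a\<close> is at least
  \<open>a ^ (n - 1) / (n - 1)!\<close>: its value at \<open>b\<close> is
  nonnegative by \<open>binomial_le_laguerre_reflected\<close>, because lowering \<open>m\<close> by one turns the hypothesis
  on \<open>b\<close> into the stronger bound \<open>2 (m - 1) \<le> b\<close>.
\<close>

lemma laguerre_reflected_growth:
  assumes "1 \<le> n" and "n \<le> m" and "2 * real m - 2 \<le> b" and "0 \<le> a"
  shows "laguerre_reflected m n b + a ^ n / fact n \<le> laguerre_reflected m n (b + a)"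
  using assms
proof (induction n arbitrary: m a rule: dec_induct)
  case base
  then show ?case by (simp add: gen_laguerre_eq_exp_bernstein exp_bernstein_def)
next
  case (step n)
  obtain M where M: "m = Suc M" using step.prems by (cases m) auto
  let ?g = "\<lambda>a. laguerre_reflected m (Suc n) (b + a) - a ^ Suc n / fact (Suc n)"
  have "?g 0 \<le> ?g a"
  proof (rule DERIV_nonneg_imp_nondecreasing[OF step.prems(3)])
    fix u :: real assume "0 \<le> u"
    have "real (M choose n) \<le> laguerre_reflected M n b"
      using step M by (intro binomial_le_laguerre_reflected) auto
    then have "0 \<le> laguerre_reflected M n (b + u) - u ^ n / fact n"
      using step.IH[of M u] step.prems M \<open>0 \<le> u\<close> by simp
    moreover have "((\<lambda>u. laguerre_reflected m (Suc n) (b + u)) has_real_derivative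
        laguerre_reflected M n (b + u) * 1) (at u)"
      unfolding M using step.prems M
      by (intro DERIV_chain2[OF laguerre_reflected_deriv]) (auto intro!: derivative_eq_intros)
    ultimately show "\<exists>y. (?g has_real_derivative y) (at u) \<and> 0 \<le> y"
      using DERIV_diff[OF _ power_over_fact_deriv] by fastforce
  qed
  then show ?case by simp
qed

text \<open>
  The growth estimate supplies a point far out where the level is reached. Intermediate values then
  need a point below the level: \<open>0\<close> itself for odd \<open>n\<close>, where the value is negative. For even \<open>n\<close> the
  value \<open>m choose n\<close> at \<open>0\<close> may equal \<open>C\<close> (as in the application with \<open>n = m\<close>), and one moves off
  \<open>0\<close> slightly, using that the polynomial decreases there.
\<close>

lemma laguerre_level_exists:
  assumes "1 \<le> n" and "n \<le> m" and C: "real (m choose n) \<le> C"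
  shows "\<exists>\<xi><0. gen_laguerre n (- real m - 1) \<xi> = C"
proof -
  let ?f = "laguerre_reflected m n"
  obtain k M where kM: "n = Suc k" "m = Suc M"
    using assms by (metis Suc_le_D order.trans One_nat_def)
  have f0: "?f 0 = (- 1) ^ n * real (m choose n)"
    using assms by (simp add: gen_laguerre_eq_exp_bernstein)
  have deriv: "(?f has_real_derivative laguerre_reflected M k y) (at y)" for y
    using laguerre_reflected_deriv[of k M y] assms kM by simp
  have cont: "continuous_on A ?f" for A
    using deriv by (intro DERIV_continuous_on) (auto intro: has_field_derivative_at_within)
  \<comment> \<open>Chosen so that the guaranteed growth \<open>a ^ n / n!\<close> is all of \<open>C\<close>.\<close>
  define a where "a = root n (fact n * C)"
  have "0 \<le> C" using C by (rule order.trans[rotated]) simp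
  then have "0 \<le> a" and a_pow: "a ^ n = fact n * C"
    using assms by (auto simp: a_def)
  have "C = a ^ n / fact n" using a_pow by simp
  also have "\<dots> \<le> ?f (2 * real m) + a ^ n / fact n"
    using binomial_le_laguerre_reflected[of n m "2 * real m"] assms by simp
  also have "\<dots> \<le> ?f (2 * real m + a)"
    using laguerre_reflected_growth[of n m "2 * real m" a] assms \<open>0 \<le> a\<close> by simp
  finally have top: "C \<le> ?f (2 * real m + a)" .
  have "0 < 2 * real m + a" using \<open>0 \<le> a\<close> assms by simp
  obtain h where h: "0 \<le> h" "h \<le> 2 * real m + a" "?f h < C"
  proof (cases "even n")
    case False
    have "0 < real (m choose n)" using assms by simp
    then have "- real (m choose n) < C" using C by linarith
    with False show ?thesis
      using that[of 0] f0 C \<open>0 < 2 * real m + a\<close> by simp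
  next
    case True
    have "laguerre_reflected M k 0 < 0"
      using True kM assms by (simp add: gen_laguerre_eq_exp_bernstein)
    from DERIV_neg_dec_right[OF deriv this]
    obtain d where d: "d > 0" "\<And>h. 0 < h \<Longrightarrow> h < d \<Longrightarrow> ?f h < ?f 0" by auto
    let ?h = "min (d / 2) (2 * real m + a)"
    have "?f ?h < ?f 0" using d \<open>0 < 2 * real m + a\<close> by (intro d(2)) auto
    also have "\<dots> \<le> C" using f0 True C by simp
    finally show ?thesis using that[of ?h] d \<open>0 < 2 * real m + a\<close> by auto
  qed
  obtain y where y: "h \<le> y" "y \<le> 2 * real m + a" "?f y = C"
    using IVT'[of ?f h C "2 * real m + a"] h top cont by auto
  then have "0 < y" using h by (cases "h = y") auto
  then show ?thesis using y(3) by (intro exI[of _ "- y"]) simp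
qed

section \<open>The stability radius\<close>

text \<open>
  For \<open>l \<le> n\<close> the coefficients \<open>\<alpha> l\<close> are \<open>1\<close>, and no others enter the \<open>n\<close>-th Bernstein coefficient
  of \<open>t \<mapsto> P (- r t)\<close>.
\<close>

lemma admissible_imp_laguerre_le:
  assumes P: "P \<in> Pi_class m n" and "n \<le> m" and "0 < r"
    and bounded: "\<And>x. - r \<le> x \<Longrightarrow> x \<le> 0 \<Longrightarrow> \<bar>poly P x\<bar> \<le> 1"
  shows "\<bar>gen_laguerre n (- real m - 1) (- r)\<bar> \<le> real ((2 * m) choose (2 * n))"
proof -
  obtain \<alpha> where \<alpha>: "\<And>k. k \<le> n \<Longrightarrow> \<alpha> k = 1" and P_eq: "P = (\<Sum>k\<le>m. monom (\<alpha> k / fact k) k)"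
    using P by (auto simp: Pi_class_def)
  define c where "c j = (\<Sum>l\<le>j. real ((m - l) choose (j - l)) * (\<alpha> l / fact l * (- r) ^ l))" for j
  have "\<bar>c n\<bar> \<le> real ((2 * m) choose (2 * n))"
  proof (rule bernstein_coeff_bound[OF _ \<open>n \<le> m\<close>])
    fix t :: real assume t: "0 \<le> t" "t \<le> 1"
    have "(\<Sum>j\<le>m. c j * t ^ j * (1 - t) ^ (m - j)) = (\<Sum>l\<le>m. \<alpha> l / fact l * (- r) ^ l * t ^ l)"
      unfolding c_def by (rule bernstein_form[symmetric])
    also have "\<dots> = poly P (- r * t)"
      unfolding P_eq poly_sum poly_monom power_mult_distrib by (simp add: mult.assoc)
    finally show "\<bar>\<Sum>j\<le>m. c j * t ^ j * (1 - t) ^ (m - j)\<bar> \<le> 1"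
      using bounded[of "- r * t"] t \<open>0 < r\<close> by (simp add: mult_left_le)
  qed
  moreover have "c n = exp_bernstein m n (- r)"
    unfolding c_def exp_bernstein_def by (intro sum.cong refl) (simp add: \<alpha>)
  ultimately show ?thesis
    using \<open>n \<le> m\<close> by (simp add: gen_laguerre_eq_exp_bernstein abs_mult power_abs)
qed

lemma parabolic_stability_radius_le:
  assumes "n \<le> m"
    and "\<And>r. 0 < r \<Longrightarrow> laguerre_reflected m n r \<le> real ((2 * m) choose (2 * n)) \<Longrightarrow> r \<le> B"
  shows "parabolic_stability_radius m n \<le> ereal B"
  unfolding parabolic_stability_radius_def stability_radius_def
proof (intro SUP_least)
  fix P :: "real poly" and r
  assume "P \<in> Pi_class m n" and "r \<in> {r. r > 0 \<and> (\<forall>x\<in>{- r..0}. \<bar>poly P x\<bar> \<le> 1)}"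
  then have "0 < r" "laguerre_reflected m n r \<le> real ((2 * m) choose (2 * n))"
    using admissible_imp_laguerre_le[of P m n r] \<open>n \<le> m\<close> by auto
  then show "ereal r \<le> ereal B" using assms(2) by simp
qed

theorem theorem7:
  fixes m n :: nat
  assumes "1 \<le> n" and "n \<le> m"
  shows "(\<exists>!\<xi>::real. \<xi> < 0 \<and>
            gen_laguerre n (- real m - 1) \<xi> - real ((2 * m) choose (2 * n)) = 0) \<and>
         (\<forall>\<xi>::real. \<xi> < 0 \<and>
            gen_laguerre n (- real m - 1) \<xi> - real ((2 * m) choose (2 * n)) = 0
            \<longrightarrow> parabolic_stability_radius m n \<le> ereal (- \<xi>)) \<and>
         parabolic_stability_radius m n \<le>
           ereal (root n (fact n) * root n (real ((2 * m) choose (2 * n)) - real (m choose n))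
                  + 2 * real m - (1 + (- 1) ^ n))"
proof (intro conjI)
  let ?C = "real ((2 * m) choose (2 * n))"
  have C: "real (m choose n) \<le> ?C"
    using binomial_le_binomial_double by simp
  have level: "\<xi> \<le> x" if "x < 0" "\<xi> < 0" "gen_laguerre n (- real m - 1) x \<le> ?C"
      "gen_laguerre n (- real m - 1) \<xi> = ?C" for x \<xi>
    using level_le_sublevel[OF \<open>n \<le> m\<close> that(1,2) C that(3,4) \<open>1 \<le> n\<close>] .
  show "\<exists>!\<xi>. \<xi> < 0 \<and> gen_laguerre n (- real m - 1) \<xi> - ?C = 0"
  proof (rule ex_ex1I)
    show "\<exists>\<xi><0. gen_laguerre n (- real m - 1) \<xi> - ?C = 0"
      using laguerre_level_exists[OF assms C] by simp
  next
    fix \<xi> \<zeta>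
    assume "\<xi> < 0 \<and> gen_laguerre n (- real m - 1) \<xi> - ?C = 0"
      and "\<zeta> < 0 \<and> gen_laguerre n (- real m - 1) \<zeta> - ?C = 0"
    then show "\<xi> = \<zeta>" using level[of \<xi> \<zeta>] level[of \<zeta> \<xi>] by simp
  qed
  show "\<forall>\<xi>. \<xi> < 0 \<and> gen_laguerre n (- real m - 1) \<xi> - ?C = 0
      \<longrightarrow> parabolic_stability_radius m n \<le> ereal (- \<xi>)"
  proof (intro allI impI parabolic_stability_radius_le[OF \<open>n \<le> m\<close>])
    fix \<xi> r :: real
    assume "\<xi> < 0 \<and> gen_laguerre n (- real m - 1) \<xi> - ?C = 0" "0 < r" "laguerre_reflected m n r \<le> ?C"
    then show "r \<le> - \<xi>" using level[of "- r" \<xi>] by simp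
  qed
  show "parabolic_stability_radius m n \<le>
      ereal (root n (fact n) * root n (?C - real (m choose n)) + 2 * real m - (1 + (- 1) ^ n))"
  proof (rule parabolic_stability_radius_le[OF \<open>n \<le> m\<close>], rule ccontr)
    fix r :: real
    define a where "a = root n (fact n) * root n (?C - real (m choose n))"
    \<comment> \<open>The point \<open>b\<close> is \<open>2 m\<close> for odd \<open>n\<close> and \<open>2 m - 2\<close> for even \<open>n\<close>: from there the polynomial only has to
      climb from \<open>m choose n\<close> to \<open>?C\<close>, which a distance \<open>a\<close> achieves.\<close>
    define b where "b = 2 * real m - (1 + (- 1) ^ n)"
    assume le: "laguerre_reflected m n r \<le> ?C"
    assume "\<not> r \<le> root n (fact n) * root n (?C - real (m choose n)) + 2 * real m - (1 + (- 1) ^ n)"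
    then have "a < r - b" by (simp add: a_def b_def)
    have "0 \<le> a" and a_pow: "a ^ n = fact n * (?C - real (m choose n))"
      using C assms by (auto simp: a_def power_mult_distrib)
    have b: "2 * real m - 2 \<le> b" "n = 1 \<Longrightarrow> 2 * real m \<le> b"
      by (cases "even n"; simp add: b_def)+
    have "?C = real (m choose n) + a ^ n / fact n" using a_pow by simp
    also have "\<dots> < laguerre_reflected m n b + (r - b) ^ n / fact n"
      using binomial_le_laguerre_reflected[OF \<open>n \<le> m\<close> b] \<open>0 \<le> a\<close> \<open>a < r - b\<close> assms
      by (intro add_le_less_mono divide_strict_right_mono power_strict_mono) auto
    also have "\<dots> \<le> laguerre_reflected m n (b + (r - b))"
      using laguerre_reflected_growth[OF assms b(1), of "r - b"] \<open>0 \<le> a\<close> \<open>a < r - b\<close> by simp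
    finally show False using le by simp
  qed
qed

end
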